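(* Let $(T,+,\Gamma)$ be a commutative ternary $\Gamma$-semiring, let $\operatorname{Spec}(T)$ be the set of all prime ideals of $T$, and for each ideal $I\subseteq T$ let $V(I)=\{P\in\operatorname{Spec}(T)\mid I\subseteq P\}$. The sets $V(I)$ satisfy the axioms of closed sets for a topology on $\operatorname{Spec}(T)$: (i) $V(0)=\operatorname{Spec}(T)$ and $V(T)=\emptyset$; (ii) $V(I\cap J)=V(I)\cup V(J)$ for all ideals $I,J$; (iii) $V\left(\sum_{\lambda\in\Lambda}I_{\lambda}\right)=\bigcap_{\lambda\in\Lambda}V(I_{\lambda})$ for every family $(I_\lambda)_{\lambda\in\Lambda}$ of ideals.
   Context: A ternary $\Gamma$-semiring $(T,+,\Gamma)$ consists of a set $T$, an addition $+$, a set $\Gamma$ of parameters, and a map $T\times\Gamma\times T\times\Gamma\times T\to T$, $(a,\alpha,b,\beta,c)\mapsto a_{\alpha}b_{\beta}c$, such that: $(T,+)$ is a commutative semigroup with identity element $0$; $(a_{\alpha}b_{\beta}c)_{\gamma}d_{\delta}e=a_{\alpha}b_{\beta}(c_{\gamma}d_{\delta}e)$; the product is additive in each of its three $T$-variables; and $0_{\alpha}b_{\beta}c=a_{\alpha}0_{\beta}c=a_{\alpha}b_{\beta}0=0$. It is commutative if $a_{\alpha}b_{\beta}c=b_{\beta}a_{\alpha}c=c_{\alpha}b_{\beta}a$ for all $a,b,c\in T$, $\alpha,\beta\in\Gamma$. An ideal is a nonempty $I\subseteq T$ closed under $+$ such that $a_{\alpha}b_{\beta}c\in I$ whenever at least one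 of $a,b,c\in T$ lies in $I$ (all $\alpha,\beta\in\Gamma$). An ideal $P\ne T$ is prime if for all $a,b,c\in T$, $\alpha,\beta\in\Gamma$: $a_{\alpha}b_{\beta}c\in P$ implies $a\in P$ or $b\in P$ or $c\in P$. $V(0)$ means $V(\{0\})$, and $\sum_\lambda I_\lambda$ is the set of finite sums of elements of the $I_\lambda$.
   Formalization: The parameter set Γ is assumed nonempty; for empty Γ the claim V(0) = Spec(T) fails, e.g. T = ℕ under addition with the prime ideal {1, 2, 3, …}, which does not contain 0. *)

theory Defs
  imports "HOL-Algebra.Ring" "HOL-Analysis.Abstract_Topology"
begin

text \<open>
  The additive structure is that of the record \<open>ring\<close>, so that \<open>abelian_monoid\<close> and \<open>finsum\<close> are
  available. The fields \<open>mult\<close> and \<open>one\<close> inherited from it are left unconstrained and play no role.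
  The term \<open>tprod T a \<alpha> b \<beta> c\<close> stands for $a_{\alpha}b_{\beta}c$.
\<close>

record ('a, 'g) ternary = "'a ring" +
  params :: "'g set"
  tprod :: "'a \<Rightarrow> 'g \<Rightarrow> 'a \<Rightarrow> 'g \<Rightarrow> 'a \<Rightarrow> 'a"

text \<open>
  The parameter set is required to be nonempty: for an empty one every nonempty additively closed
  proper subset would be a prime ideal, whether or not it contains the zero element.
\<close>

locale ternary_gamma_semiring = abelian_monoid T
  for T :: "('a, 'g, 'm) ternary_scheme" (structure) +
  assumes params_nonempty: "params T \<noteq> {}"
    and tprod_closed:
      "\<lbrakk>a \<in> carrier T; b \<in> carrier T; c \<in> carrier T; \<alpha> \<in> params T; \<beta> \<in> params T\<rbrakk>
        \<Longrightarrow> tprod T a \<alpha> b \<beta> c \<in> carrier T"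
    and tprod_assoc:
      "\<lbrakk>a \<in> carrier T; b \<in> carrier T; c \<in> carrier T; d \<in> carrier T; e \<in> carrier T;
        \<alpha> \<in> params T; \<beta> \<in> params T; \<gamma> \<in> params T; \<delta> \<in> params T\<rbrakk>
        \<Longrightarrow> tprod T (tprod T a \<alpha> b \<beta> c) \<gamma> d \<delta> e = tprod T a \<alpha> b \<beta> (tprod T c \<gamma> d \<delta> e)"
    and tprod_add_left:
      "\<lbrakk>a \<in> carrier T; a' \<in> carrier T; b \<in> carrier T; c \<in> carrier T; \<alpha> \<in> params T; \<beta> \<in> params T\<rbrakk>
        \<Longrightarrow> tprod T (a \<oplus> a') \<alpha> b \<beta> c = tprod T a \<alpha> b \<beta> c \<oplus> tprod T a' \<alpha> b \<beta> c"
    and tprod_add_middle: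
      "\<lbrakk>a \<in> carrier T; b \<in> carrier T; b' \<in> carrier T; c \<in> carrier T; \<alpha> \<in> params T; \<beta> \<in> params T\<rbrakk>
        \<Longrightarrow> tprod T a \<alpha> (b \<oplus> b') \<beta> c = tprod T a \<alpha> b \<beta> c \<oplus> tprod T a \<alpha> b' \<beta> c"
    and tprod_add_right:
      "\<lbrakk>a \<in> carrier T; b \<in> carrier T; c \<in> carrier T; c' \<in> carrier T; \<alpha> \<in> params T; \<beta> \<in> params T\<rbrakk>
        \<Longrightarrow> tprod T a \<alpha> b \<beta> (c \<oplus> c') = tprod T a \<alpha> b \<beta> c \<oplus> tprod T a \<alpha> b \<beta> c'"
    and tprod_zero_left:
      "\<lbrakk>b \<in> carrier T; c \<in> carrier T; \<alpha> \<in> params T; \<beta> \<in> params T\<rbrakk> \<Longrightarrow> tprod T \<zero> \<alpha> b \<beta> c = \<zero>"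
    and tprod_zero_middle:
      "\<lbrakk>a \<in> carrier T; c \<in> carrier T; \<alpha> \<in> params T; \<beta> \<in> params T\<rbrakk> \<Longrightarrow> tprod T a \<alpha> \<zero> \<beta> c = \<zero>"
    and tprod_zero_right:
      "\<lbrakk>a \<in> carrier T; b \<in> carrier T; \<alpha> \<in> params T; \<beta> \<in> params T\<rbrakk> \<Longrightarrow> tprod T a \<alpha> b \<beta> \<zero> = \<zero>"

locale comm_ternary_gamma_semiring = ternary_gamma_semiring +
  assumes tprod_comm_left:
      "\<lbrakk>a \<in> carrier T; b \<in> carrier T; c \<in> carrier T; \<alpha> \<in> params T; \<beta> \<in> params T\<rbrakk>
        \<Longrightarrow> tprod T a \<alpha> b \<beta> c = tprod T b \<alpha> a \<beta> c"
    and tprod_comm_outer: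
      "\<lbrakk>a \<in> carrier T; b \<in> carrier T; c \<in> carrier T; \<alpha> \<in> params T; \<beta> \<in> params T\<rbrakk>
        \<Longrightarrow> tprod T a \<alpha> b \<beta> c = tprod T c \<alpha> b \<beta> a"

definition tideal :: "('a, 'g, 'm) ternary_scheme \<Rightarrow> 'a set \<Rightarrow> bool" where
  "tideal T I \<longleftrightarrow> I \<noteq> {} \<and> I \<subseteq> carrier T \<and>
     (\<forall>a\<in>I. \<forall>b\<in>I. a \<oplus>\<^bsub>T\<^esub> b \<in> I) \<and>
     (\<forall>a\<in>carrier T. \<forall>b\<in>carrier T. \<forall>c\<in>carrier T. \<forall>\<alpha>\<in>params T. \<forall>\<beta>\<in>params T.
        a \<in> I \<or> b \<in> I \<or> c \<in> I \<longrightarrow> tprod T a \<alpha> b \<beta> c \<in> I)"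

definition prime_tideal :: "('a, 'g, 'm) ternary_scheme \<Rightarrow> 'a set \<Rightarrow> bool" where
  "prime_tideal T P \<longleftrightarrow> tideal T P \<and> P \<noteq> carrier T \<and>
     (\<forall>a\<in>carrier T. \<forall>b\<in>carrier T. \<forall>c\<in>carrier T. \<forall>\<alpha>\<in>params T. \<forall>\<beta>\<in>params T.
        tprod T a \<alpha> b \<beta> c \<in> P \<longrightarrow> a \<in> P \<or> b \<in> P \<or> c \<in> P)"

definition tSpec :: "('a, 'g, 'm) ternary_scheme \<Rightarrow> 'a set set" where
  "tSpec T = {P. prime_tideal T P}"

definition tV :: "('a, 'g, 'm) ternary_scheme \<Rightarrow> 'a set \<Rightarrow> 'a set set" where
  "tV T I = {P \<in> tSpec T. I \<subseteq> P}"

text \<open>The empty sum is included, so the sum of the empty family is \<open>{\<zero>}\<close>.\<close>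

definition tideal_sum :: "('a, 'g, 'm) ternary_scheme \<Rightarrow> 'i set \<Rightarrow> ('i \<Rightarrow> 'a set) \<Rightarrow> 'a set" where
  "tideal_sum T \<Lambda> I =
     {finsum T x {..<n} | (n :: nat) x. \<forall>k<n. x k \<in> (\<Union>l\<in>\<Lambda>. I l)}"

end

theory Submission
  imports Defs
begin

text \<open>
  If a prime ideal \<open>P\<close> contains \<open>I \<inter> J\<close> but neither \<open>a \<in> I\<close> nor \<open>b \<in> J\<close>, then the product of
  \<open>a\<close>, \<open>b\<close>, \<open>b\<close> lies in \<open>I \<inter> J \<subseteq> P\<close>, contradicting primality; so \<open>V(I \<inter> J) = V(I) \<union> V(J)\<close>.
  The sum of a family of ideals is the least ideal containing all members, which turns
  intersections of sets \<open>V(I)\<close> into sets of the same form.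
\<close>

section \<open>Ideals and the sets V(I)\<close>

lemma tideal_carrier: "tideal T I \<Longrightarrow> a \<in> I \<Longrightarrow> a \<in> carrier T"
  by (auto simp: tideal_def)

lemma tideal_add: "tideal T I \<Longrightarrow> a \<in> I \<Longrightarrow> b \<in> I \<Longrightarrow> a \<oplus>\<^bsub>T\<^esub> b \<in> I"
  by (auto simp: tideal_def)

lemma tideal_tprod:
  assumes "tideal T I" "a \<in> carrier T" "b \<in> carrier T" "c \<in> carrier T" "\<alpha> \<in> params T" "\<beta> \<in> params T"
    and "a \<in> I \<or> b \<in> I \<or> c \<in> I"
  shows "tprod T a \<alpha> b \<beta> c \<in> I"
  using assms by (auto simp: tideal_def)

lemma tidealI:
  assumes "\<zero>\<^bsub>T\<^esub> \<in> I" "I \<subseteq> carrier T"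
    and "\<And>a b. a \<in> I \<Longrightarrow> b \<in> I \<Longrightarrow> a \<oplus>\<^bsub>T\<^esub> b \<in> I"
    and "\<And>a b c \<alpha> \<beta>. \<lbrakk>a \<in> carrier T; b \<in> carrier T; c \<in> carrier T; \<alpha> \<in> params T; \<beta> \<in> params T;
      a \<in> I \<or> b \<in> I \<or> c \<in> I\<rbrakk> \<Longrightarrow> tprod T a \<alpha> b \<beta> c \<in> I"
  shows "tideal T I"
  unfolding tideal_def using assms by (intro conjI ballI impI) auto

lemma tSpec_tideal: "P \<in> tSpec T \<Longrightarrow> tideal T P"
  by (simp add: tSpec_def prime_tideal_def)

context ternary_gamma_semiring
begin

text \<open>Absorption supplies zero: any \<open>a\<close> in \<open>I\<close> and any parameter
  give the product of \<open>a\<close> with two zeros, which vanishes. Nonemptiness of the parameter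
  set guarantees that such a product exists.\<close>

lemma tideal_zero:
  assumes "tideal T I"
  shows "\<zero> \<in> I"
proof -
  obtain a \<alpha> where a: "a \<in> I" and \<alpha>: "\<alpha> \<in> params T"
    using assms params_nonempty by (auto simp: tideal_def)
  have "a \<in> carrier T"
    using assms a by (rule tideal_carrier)
  then have "tprod T a \<alpha> \<zero> \<alpha> \<zero> \<in> I"
    using assms a \<alpha> by (intro tideal_tprod) auto
  with \<open>a \<in> carrier T\<close> \<alpha> show ?thesis
    by (simp add: tprod_zero_right)
qed

lemma tideal_whole: "tideal T (carrier T)"
  by (auto simp: tideal_def tprod_closed)

lemma tideal_Int:
  assumes "tideal T I" "tideal T J"
  shows "tideal T (I \<inter> J)"
proof -
  have "\<zero> \<in> I \<inter> J"
    using assms by (simp add: tideal_zero)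
  then show ?thesis
    using assms tideal_carrier[OF assms(1)]
    by (intro tidealI) (auto intro: tideal_add tideal_tprod)
qed

lemma tV_zero: "tV T {\<zero>} = tSpec T"
  by (auto simp: tV_def intro: tideal_zero tSpec_tideal)

lemma tV_carrier: "tV T (carrier T) = {}"
  by (auto simp: tV_def tSpec_def prime_tideal_def tideal_def)

lemma tV_Int:
  assumes "tideal T I" "tideal T J"
  shows "tV T (I \<inter> J) = tV T I \<union> tV T J"
proof
  show "tV T (I \<inter> J) \<subseteq> tV T I \<union> tV T J"
  proof
    fix P assume P: "P \<in> tV T (I \<inter> J)"
    have "I \<subseteq> P \<or> J \<subseteq> P"
    proof (rule ccontr)
      assume "\<not> (I \<subseteq> P \<or> J \<subseteq> P)"
      then obtain a b where a: "a \<in> I" "a \<notin> P" and b: "b \<in> J" "b \<notin> P"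
        by blast
      obtain \<alpha> where \<alpha>: "\<alpha> \<in> params T"
        using params_nonempty by blast
      have ab: "a \<in> carrier T" "b \<in> carrier T"
        using assms a b by (auto intro: tideal_carrier)
      \<comment> \<open>Only two witnesses are available for three slots, so \<open>b\<close> is
        repeated; primality then still yields just \<open>a\<close> or \<open>b\<close> in
        \<open>P\<close>.\<close>
      have "tprod T a \<alpha> b \<alpha> b \<in> I \<inter> J"
        using assms a b ab \<alpha> by (auto intro: tideal_tprod)
      then have "tprod T a \<alpha> b \<alpha> b \<in> P"
        using P by (auto simp: tV_def)
      then show False
        using P a b ab \<alpha> unfolding tV_def tSpec_def prime_tideal_def by blast
    qed
    with P show "P \<in> tV T I \<union> tV T J"
      by (auto simp: tV_def)
  qed
qed (auto simp: tV_def)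

section \<open>Finite sums over a family of ideals\<close>

lemma tideal_sum_zero: "\<zero> \<in> tideal_sum T \<Lambda> I"
  unfolding tideal_sum_def by (rule CollectI, rule exI[of _ 0]) simp

lemma tideal_sum_snoc:
  assumes "\<And>l. l \<in> \<Lambda> \<Longrightarrow> tideal T (I l)" "s \<in> tideal_sum T \<Lambda> I" "l \<in> \<Lambda>" "y \<in> I l"
  shows "s \<oplus> y \<in> tideal_sum T \<Lambda> I"
proof -
  obtain n :: nat and x where s: "s = finsum T x {..<n}" and x: "\<forall>k<n. x k \<in> (\<Union>l\<in>\<Lambda>. I l)"
    using assms(2) by (auto simp: tideal_sum_def)
  have xc: "x k \<in> carrier T" if "k < n" for k
    using x that assms(1) by (meson UN_E tideal_carrier)
  have y: "y \<in> carrier T"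
    using assms by (meson tideal_carrier)
  \<comment> \<open>The new term sits at index \<open>n\<close>, outside \<open>{..<n}\<close>, so
    the old sum is unchanged. It is split off in front, whence the later commutation.\<close>
  have "finsum T (x(n := y)) {..<Suc n} = y \<oplus> finsum T (x(n := y)) {..<n}"
    using xc y by (simp add: lessThan_Suc Pi_def)
  also have "finsum T (x(n := y)) {..<n} = s"
    unfolding s using xc by (intro finsum_cong') auto
  also have "y \<oplus> s = s \<oplus> y"
    using y xc s by (intro a_comm) (auto intro: finsum_closed)
  finally have "s \<oplus> y = finsum T (x(n := y)) {..<Suc n}" ..
  moreover have "\<forall>k<Suc n. (x(n := y)) k \<in> (\<Union>l\<in>\<Lambda>. I l)"
    using x assms(3,4) by (auto simp: less_Suc_eq)
  ultimately show ?thesis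
    unfolding tideal_sum_def by blast
qed

text \<open>Every finite sum arises from zero by appending one term at a time. Later proofs can thus
  avoid index sets; the case \<open>ideal\<close> merely discharges the assumption on the
  family.\<close>

lemma tideal_sum_induct [consumes 1, case_names ideal zero snoc]:
  assumes s: "s \<in> tideal_sum T \<Lambda> I"
    and ideals: "\<And>l. l \<in> \<Lambda> \<Longrightarrow> tideal T (I l)"
    and zero: "Q \<zero>"
    and snoc: "\<And>s l y. \<lbrakk>s \<in> carrier T; Q s; l \<in> \<Lambda>; y \<in> I l; y \<in> carrier T\<rbrakk> \<Longrightarrow> Q (s \<oplus> y)"
  shows "Q s"
proof -
  have "Q (finsum T x {..<n})" if "\<forall>k<n. x k \<in> (\<Union>l\<in>\<Lambda>. I l)" for n :: nat and x
    using that
  proof (induction n)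
    case 0
    then show ?case using zero by simp
  next
    case (Suc n)
    have xc: "x k \<in> carrier T" if "k < Suc n" for k
      using Suc.prems that ideals by (meson UN_E tideal_carrier)
    then have closed: "finsum T x {..<n} \<in> carrier T"
      by (intro finsum_closed) auto
    obtain l where l: "l \<in> \<Lambda>" "x n \<in> I l"
      using Suc.prems by auto
    have "finsum T x {..<Suc n} = finsum T x {..<n} \<oplus> x n"
      using xc closed by (simp add: lessThan_Suc Pi_def a_comm)
    moreover have "Q (finsum T x {..<n} \<oplus> x n)"
      using closed l Suc xc by (intro snoc) auto
    ultimately show ?case by simp
  qed
  then show ?thesis
    using s unfolding tideal_sum_def by blast
qed

lemma tideal_sum_upper:
  assumes "\<And>l. l \<in> \<Lambda> \<Longrightarrow> tideal T (I l)" "l \<in> \<Lambda>"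
  shows "I l \<subseteq> tideal_sum T \<Lambda> I"
proof
  fix y assume y: "y \<in> I l"
  then have "\<zero> \<oplus> y \<in> tideal_sum T \<Lambda> I"
    using assms tideal_sum_zero by (intro tideal_sum_snoc) auto
  moreover have "y \<in> carrier T"
    using assms y by (meson tideal_carrier)
  ultimately show "y \<in> tideal_sum T \<Lambda> I"
    by simp
qed

text \<open>\<open>J\<close> contains zero and is closed under addition, so appending terms never
  leaves it.\<close>

lemma tideal_sum_least:
  assumes "\<And>l. l \<in> \<Lambda> \<Longrightarrow> tideal T (I l)" "tideal T J" "\<And>l. l \<in> \<Lambda> \<Longrightarrow> I l \<subseteq> J"
  shows "tideal_sum T \<Lambda> I \<subseteq> J"
proof
  fix s assume "s \<in> tideal_sum T \<Lambda> I"
  then show "s \<in> J"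
  proof (induction rule: tideal_sum_induct)
    case (ideal l)
    then show ?case by (rule assms(1))
  next
    case zero
    show ?case using assms(2) by (rule tideal_zero)
  next
    case (snoc s l y)
    then show ?case using assms by (blast intro: tideal_add)
  qed
qed

lemma tideal_sum_carrier:
  assumes "\<And>l. l \<in> \<Lambda> \<Longrightarrow> tideal T (I l)"
  shows "tideal_sum T \<Lambda> I \<subseteq> carrier T"
  using assms tideal_whole
proof (rule tideal_sum_least)
  show "I l \<subseteq> carrier T" if "l \<in> \<Lambda>" for l
    using assms[OF that] by (auto simp: tideal_def)
qed

text \<open>A prime ideal is itself an ideal, so it contains the sum exactly when it contains each
  member. Intersecting with \<open>tSpec T\<close> gives the right value for the empty family, whose
  bare intersection would be the whole type.\<close>

lemma tV_sum:
  assumes "\<And>l. l \<in> \<Lambda> \<Longrightarrow> tideal T (I l)"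
  shows "tV T (tideal_sum T \<Lambda> I) = tSpec T \<inter> (\<Inter>l\<in>\<Lambda>. tV T (I l))"
proof -
  have "tideal_sum T \<Lambda> I \<subseteq> P \<longleftrightarrow> (\<forall>l\<in>\<Lambda>. I l \<subseteq> P)" if "P \<in> tSpec T" for P
    using tideal_sum_upper[of \<Lambda> I] tideal_sum_least[of \<Lambda> I P] assms tSpec_tideal[OF that]
    by blast
  then show ?thesis
    by (auto simp: tV_def)
qed

text \<open>Induction on \<open>t\<close>: associativity moves its last term outside, which replaces
  a concatenation of two indexed families.\<close>

lemma tideal_sum_add:
  assumes ideals: "\<And>l. l \<in> \<Lambda> \<Longrightarrow> tideal T (I l)"
    and s: "s \<in> tideal_sum T \<Lambda> I" and t: "t \<in> tideal_sum T \<Lambda> I"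
  shows "s \<oplus> t \<in> tideal_sum T \<Lambda> I"
proof -
  have sc: "s \<in> carrier T"
    using tideal_sum_carrier[OF ideals] s by (rule subsetD)
  from t show ?thesis
  proof (induction rule: tideal_sum_induct)
    case (ideal l)
    then show ?case by (rule ideals)
  next
    case zero
    then show ?case using s sc by simp
  next
    case (snoc t l y)
    then have "(s \<oplus> t) \<oplus> y \<in> tideal_sum T \<Lambda> I"
      using ideals by (metis tideal_sum_snoc)
    with snoc sc show ?case
      by (simp add: a_assoc)
  qed
qed

end

section \<open>The sum as an ideal and the Zariski topology\<close>

context comm_ternary_gamma_semiring
begin

text \<open>Additivity in the first variable reduces absorption there to the single terms, each
  absorbed by its own ideal. Commutativity carries the other two positions to the first.\<close>

lemma tideal_tideal_sum:
  assumes ideals: "\<And>l. l \<in> \<Lambda> \<Longrightarrow> tideal T (I l)"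
  shows "tideal T (tideal_sum T \<Lambda> I)"
proof -
  let ?S = "tideal_sum T \<Lambda> I"
  have S: "?S \<subseteq> carrier T"
    using ideals by (rule tideal_sum_carrier)
  have left: "tprod T s \<alpha> b \<beta> c \<in> ?S"
    if "s \<in> ?S" and b: "b \<in> carrier T" and c: "c \<in> carrier T"
      and \<alpha>: "\<alpha> \<in> params T" and \<beta>: "\<beta> \<in> params T" for s \<alpha> b \<beta> c
    using \<open>s \<in> ?S\<close>
  proof (induction rule: tideal_sum_induct)
    case (ideal l)
    then show ?case by (rule ideals)
  next
    case zero
    then show ?case using b c \<alpha> \<beta> by (simp add: tprod_zero_left tideal_sum_zero)
  next
    case (snoc s l y)
    then have "tprod T y \<alpha> b \<beta> c \<in> I l"
      using ideals b c \<alpha> \<beta> by (intro tideal_tprod) auto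
    with snoc have "tprod T s \<alpha> b \<beta> c \<oplus> tprod T y \<alpha> b \<beta> c \<in> ?S"
      using ideals by (intro tideal_sum_snoc)
    with snoc b c \<alpha> \<beta> show ?case
      by (simp add: tprod_add_left)
  qed
  have "tprod T a \<alpha> b \<beta> c \<in> ?S"
    if "a \<in> carrier T" "b \<in> carrier T" "c \<in> carrier T" "\<alpha> \<in> params T" "\<beta> \<in> params T"
      and "a \<in> ?S \<or> b \<in> ?S \<or> c \<in> ?S" for a \<alpha> b \<beta> c
    using that(6)
  proof (elim disjE)
    assume "a \<in> ?S"
    with that show ?thesis by (intro left)
  next
    assume "b \<in> ?S"
    with that have "tprod T b \<alpha> a \<beta> c \<in> ?S" by (intro left)
    then show ?thesis by (simp only: tprod_comm_left[OF that(1-5)])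
  next
    assume "c \<in> ?S"
    with that have "tprod T c \<alpha> b \<beta> a \<in> ?S" by (intro left)
    then show ?thesis by (simp only: tprod_comm_outer[OF that(1-5)])
  qed
  moreover have "\<forall>s\<in>?S. \<forall>t\<in>?S. s \<oplus> t \<in> ?S"
    using tideal_sum_add[of \<Lambda> I] ideals by simp
  ultimately show ?thesis
    using S tideal_sum_zero[of \<Lambda> I] by (intro tidealI) auto
qed

lemma zariski_topology_exists:
  "\<exists>X. topspace X = tSpec T \<and> (\<forall>C. closedin X C \<longleftrightarrow> (\<exists>I. tideal T I \<and> C = tV T I))"
proof -
  \<comment> \<open>Open sets are the complements of the V(I). The inclusion in
    \<open>tSpec T\<close> is imposed since the difference \<open>tSpec T - U\<close> does not see
    points of \<open>U\<close> outside the spectrum.\<close>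
  define L where "L U \<longleftrightarrow> U \<subseteq> tSpec T \<and> (\<exists>I. tideal T I \<and> tSpec T - U = tV T I)" for U
  have "istopology L"
    unfolding istopology_def
  proof (intro conjI allI impI)
    fix U V assume "L U" "L V"
    then obtain I J where "tideal T I" "tSpec T - U = tV T I" "tideal T J" "tSpec T - V = tV T J"
      and U: "U \<subseteq> tSpec T"
      by (auto simp: L_def)
    then have "tideal T (I \<inter> J)" "tSpec T - U \<inter> V = tV T (I \<inter> J)"
      by (auto simp: tideal_Int tV_Int Diff_Int)
    then show "L (U \<inter> V)"
      using U by (auto simp: L_def)
  next
    fix \<K> assume "\<forall>K\<in>\<K>. L K"
    \<comment> \<open>One ideal is chosen for each open set, so the family is indexed by the open
      sets themselves.\<close>
    then obtain I where I: "\<And>K. K \<in> \<K> \<Longrightarrow> tideal T (I K)"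
        "\<And>K. K \<in> \<K> \<Longrightarrow> tSpec T - K = tV T (I K)" and sub: "\<Union>\<K> \<subseteq> tSpec T"
      unfolding L_def by (metis Sup_le_iff)
    have "tSpec T - \<Union>\<K> = tSpec T \<inter> (\<Inter>K\<in>\<K>. tSpec T - K)"
      by blast
    also have "\<dots> = tV T (tideal_sum T \<K> I)"
      using I by (simp add: tV_sum)
    finally show "L (\<Union>\<K>)"
      using sub tideal_tideal_sum[of \<K> I] I(1) by (auto simp: L_def)
  qed
  then have open_iff: "openin (topology L) = L"
    by (rule topology_inverse')
  \<comment> \<open>\<open>istopology\<close> does not fix the underlying space. The spectrum is
    open as the complement of V(T), which is empty, and it contains every open set.\<close>
  have "L (tSpec T)"
    using tideal_whole tV_carrier by (auto simp: L_def)
  then have space: "topspace (topology L) = tSpec T"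
    using openin_subset[of "topology L" "tSpec T"] openin_topspace[of "topology L"]
    unfolding open_iff by (auto simp: L_def)
  have "closedin (topology L) C \<longleftrightarrow> (\<exists>I. tideal T I \<and> C = tV T I)" for C
  proof -
    \<comment> \<open>Complementing twice within the spectrum returns \<open>C\<close>, and each
      V(I) lies in the spectrum.\<close>
    have "closedin (topology L) C \<longleftrightarrow> C \<subseteq> tSpec T \<and> (\<exists>I. tideal T I \<and> tSpec T - (tSpec T - C) = tV T I)"
      by (auto simp: closedin_def space open_iff L_def)
    also have "\<dots> \<longleftrightarrow> (\<exists>I. tideal T I \<and> C = tV T I)"
      by (auto simp: double_diff tV_def)
    finally show ?thesis .
  qed
  with space show ?thesis by blast
qed

end

theorem theorem7p12:
  fixes T :: "('a, 'g, 'm) ternary_scheme"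
  assumes "comm_ternary_gamma_semiring T"
  shows "(\<exists>X. topspace X = tSpec T \<and>
            (\<forall>C. closedin X C \<longleftrightarrow> (\<exists>I. tideal T I \<and> C = tV T I)))
    \<and> tV T {\<zero>\<^bsub>T\<^esub>} = tSpec T \<and> tV T (carrier T) = {}
    \<and> (\<forall>I J. tideal T I \<and> tideal T J \<longrightarrow> tV T (I \<inter> J) = tV T I \<union> tV T J)
    \<and> (\<forall>(\<Lambda> :: 'i set) I. (\<forall>l\<in>\<Lambda>. tideal T (I l)) \<longrightarrow>
          tV T (tideal_sum T \<Lambda> I) = tSpec T \<inter> (\<Inter>l\<in>\<Lambda>. tV T (I l)))"
proof -
  interpret comm_ternary_gamma_semiring T by (rule assms)
  show ?thesis
    using zariski_topology_exists tV_zero tV_carrier by (simp add: tV_Int tV_sum)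
qed

end
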